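(* There exists an NMFDP whose fairness objective requires unbounded memory. Specifically, there is an NMFDP with fairness function $F$ for which there do not exist all of the following: a finite set $M$ of memory states; an initial memory $m_{\text{init}}\in M$; a memory update function $g:M\times A\times S\to M$; and a function $F':S\times M\to\mathbb{R}$, such that $F(\tau_{1,t})=F'(s_{t+1},m_{t+1})$ for every bounded trace $\tau_{1,t}$ and every $t$. Here $m_1=m_{\text{init}}$ and $m_{k+1}=g(m_k,a_k,s_{k+1})$. An example is the two-stakeholder doughnut process with $S=\{s_{\text{init}}\}$, $A=\{toX,toY\}$ and $$F(\tau_{1,T})=\Big|\sum_{t=1}^T\mathbb{I}(a_t=toX)-\sum_{t=1}^T\mathbb{I}(a_t=toY)\Big|.$$
   Context: An NMFDP is a tuple $\langle S,s_{\text{init}},A,P,R_1,\dots,R_n,\gamma,F\rangle$ with the following components: a finite state set $S$; an initial state $s_{\text{init}}$; a finite action set $A$; a transition distribution $P$; Markovian stakeholder rewards $R_i:S\times A\times S\to\mathbb{R}$; a discount factor $\gamma\in(0,1]$; and a non-Markovian fairness function $F:(S\times A)^+\times S\to\mathbb{R}$ evaluated on bounded traces $\tau_{1,t}=s_1,a_1,\dots,s_t,a_t,s_{t+1}$ with $s_1=s_{\text{init}}$. In the example, $toX$ and $toY$ are the actions that allocate one doughnut to stakeholder $X$ and to stakeholder $Y$ respectively. *)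

theory Defs
  imports Complex_Main
begin

text \<open>A bounded trace
  s_1,a_1,...,s_t,a_t,s_{t+1} is represented by the nonempty list
  [(s_1,a_1),...,(s_t,a_t)] together with the final state s_{t+1}.\<close>

record ('s, 'a) nmfdp =
  states :: "'s set"
  s_init :: 's
  actions :: "'a set"
  trans :: "'s \<Rightarrow> 'a \<Rightarrow> 's \<Rightarrow> real"
  rewards :: "('s \<Rightarrow> 'a \<Rightarrow> 's \<Rightarrow> real) list"
  discount :: real
  fairness :: "('s \<times> 'a) list \<Rightarrow> 's \<Rightarrow> real"

definition wf_nmfdp :: "('s, 'a) nmfdp \<Rightarrow> bool" where
  "wf_nmfdp N \<longleftrightarrow>
     finite (states N) \<and> s_init N \<in> states N \<and>
     finite (actions N) \<and> actions N \<noteq> {} \<and>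
     (\<forall>s\<in>states N. \<forall>a\<in>actions N.
        (\<forall>s'. trans N s a s' \<ge> 0) \<and>
        (\<forall>s'. s' \<notin> states N \<longrightarrow> trans N s a s' = 0) \<and>
        (\<Sum>s'\<in>states N. trans N s a s') = 1) \<and>
     0 < discount N \<and> discount N \<le> 1"

definition trace_states :: "('s \<times> 'a) list \<Rightarrow> 's \<Rightarrow> 's list" where
  "trace_states xs s' = map fst xs @ [s']"

definition is_trace :: "('s, 'a) nmfdp \<Rightarrow> ('s \<times> 'a) list \<Rightarrow> 's \<Rightarrow> bool" where
  "is_trace N xs s' \<longleftrightarrow>
     xs \<noteq> [] \<and> fst (hd xs) = s_init N \<and>
     (\<forall>s\<in>set (trace_states xs s'). s \<in> states N) \<and>
     (\<forall>p\<in>set xs. snd p \<in> actions N) \<and>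
     (\<forall>i<length xs. trans N (trace_states xs s' ! i) (snd (xs ! i))
                               (trace_states xs s' ! Suc i) > 0)"

text \<open>Memory after the trace: m_1 = m_init, m_{k+1} = g(m_k, a_k, s_{k+1});
  returns m_{t+1}.\<close>
definition mem_after :: "('m \<Rightarrow> 'a \<Rightarrow> 's \<Rightarrow> 'm) \<Rightarrow> 'm \<Rightarrow> ('s \<times> 'a) list \<Rightarrow> 's \<Rightarrow> 'm" where
  "mem_after g m0 xs s' =
     foldl (\<lambda>m (a, s). g m a s) m0 (zip (map snd xs) (tl (trace_states xs s')))"

definition finite_memory_fairness ::
  "('s, 'a) nmfdp \<Rightarrow> 'm set \<Rightarrow> 'm \<Rightarrow> ('m \<Rightarrow> 'a \<Rightarrow> 's \<Rightarrow> 'm) \<Rightarrow> ('s \<Rightarrow> 'm \<Rightarrow> real) \<Rightarrow> bool" where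
  "finite_memory_fairness N M m_init g F' \<longleftrightarrow>
     finite M \<and> m_init \<in> M \<and>
     (\<forall>m\<in>M. \<forall>a\<in>actions N. \<forall>s\<in>states N. g m a s \<in> M) \<and>
     (\<forall>xs s'. is_trace N xs s' \<longrightarrow> fairness N xs s' = F' s' (mem_after g m_init xs s'))"

end

theory Submission
  imports Defs
begin

text \<open>Along a trace the memory never leaves the finite carrier M, so a finite-memory
  representation lets the fairness of the traces ending in a fixed state take only the
  finitely many values of F' on that state. In the doughnut process, giving every doughnut
  to X for k steps has fairness k, so the fairness values are unbounded.\<close>

lemma foldl_closed:
  assumes "\<And>m x. m \<in> M \<Longrightarrow> x \<in> set xs \<Longrightarrow> f m x \<in> M" and "m \<in> M"
  shows "foldl f m xs \<in> M"
  using assms by (induction xs arbitrary: m) auto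

lemma mem_after_in_carrier:
  assumes closed: "\<forall>m\<in>M. \<forall>a\<in>actions N. \<forall>s\<in>states N. g m a s \<in> M"
    and "m_init \<in> M" and trace: "is_trace N xs s'"
  shows "mem_after g m_init xs s' \<in> M"
  unfolding mem_after_def
proof (rule foldl_closed[OF _ \<open>m_init \<in> M\<close>])
  fix m x
  assume "m \<in> M" and x: "x \<in> set (zip (map snd xs) (tl (trace_states xs s')))"
  obtain a s where as: "x = (a, s)" by fastforce
  have "a \<in> snd ` set xs"
    using x as by (auto dest: set_zip_leftD)
  then have "a \<in> actions N"
    using trace by (auto simp: is_trace_def)
  moreover have "s \<in> set (tl (trace_states xs s'))"
    using x as by (auto dest: set_zip_rightD)
  then have "s \<in> set (trace_states xs s')"
    by (rule list.set_sel(2)[rotated]) (simp add: trace_states_def)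
  then have "s \<in> states N"
    using trace by (auto simp: is_trace_def)
  ultimately show "(\<lambda>m (a, s). g m a s) m x \<in> M"
    using closed \<open>m \<in> M\<close> as by simp
qed

lemma finite_memory_fairness_finite_values:
  assumes "finite_memory_fairness N M m_init g F'"
  shows "finite {fairness N xs s' | xs. is_trace N xs s'}"
proof (rule finite_subset)
  show "finite (F' s' ` M)"
    using assms by (simp add: finite_memory_fairness_def)
  show "{fairness N xs s' | xs. is_trace N xs s'} \<subseteq> F' s' ` M"
  proof
    fix v
    assume "v \<in> {fairness N xs s' | xs. is_trace N xs s'}"
    then obtain xs where v: "v = fairness N xs s'" and trace: "is_trace N xs s'"
      by blast
    have "v = F' s' (mem_after g m_init xs s')" and "mem_after g m_init xs s' \<in> M"
      using assms v trace mem_after_in_carrier by (auto simp: finite_memory_fairness_def)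
    then show "v \<in> F' s' ` M"
      by blast
  qed
qed

text \<open>The single state is 0; action 0 is toX and action 1 is toY.\<close>

definition doughnut :: "(nat, nat) nmfdp" where
  "doughnut = \<lparr> states = {0}, s_init = 0, actions = {0, 1},
     trans = (\<lambda>s a s'. if s' = 0 then 1 else 0), rewards = [], discount = 1,
     fairness = (\<lambda>xs s'. \<bar>real (length (filter (\<lambda>p. snd p = 0) xs))
                         - real (length (filter (\<lambda>p. snd p = 1) xs))\<bar>) \<rparr>"

lemma wf_doughnut: "wf_nmfdp doughnut"
  unfolding wf_nmfdp_def doughnut_def by auto

lemma is_trace_doughnut_all_toX: "is_trace doughnut (replicate (Suc k) (0, 0)) 0"
proof -
  have states: "trace_states (replicate (Suc k) (0, 0)) 0 = replicate (Suc (Suc k)) (0::nat)"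
    unfolding trace_states_def by (simp add: replicate_append_same)
  show ?thesis
    unfolding is_trace_def states by (simp add: doughnut_def del: replicate_Suc)
qed

lemma fairness_doughnut_all_toX: "fairness doughnut (replicate k (0, 0)) 0 = real k"
  by (simp add: doughnut_def)

lemma infinite_doughnut_fairness_values:
  "infinite {fairness doughnut xs 0 | xs. is_trace doughnut xs 0}"
proof
  assume "finite {fairness doughnut xs 0 | xs. is_trace doughnut xs 0}"
  moreover have "real (Suc k) \<in> {fairness doughnut xs 0 | xs. is_trace doughnut xs 0}" for k
    using is_trace_doughnut_all_toX[of k]
    by (intro CollectI exI[of _ "replicate (Suc k) (0, 0)"] conjI) (simp_all only: fairness_doughnut_all_toX)
  then have "range (\<lambda>k. real (Suc k)) \<subseteq> {fairness doughnut xs 0 | xs. is_trace doughnut xs 0}"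
    by blast
  ultimately have "finite (range (\<lambda>k. real (Suc k)))"
    by (rule finite_subset[rotated])
  then show False
    by (auto dest: finite_imageD simp: inj_on_def)
qed

theorem corollary1:
  shows "\<exists>N :: (nat, nat) nmfdp. wf_nmfdp N \<and>
           \<not> (\<exists>(M :: 'm set) m_init g F'. finite_memory_fairness N M m_init g F')"
proof (intro exI conjI notI)
  show "wf_nmfdp doughnut"
    by (rule wf_doughnut)
  assume "\<exists>(M :: 'm set) m_init g F'. finite_memory_fairness doughnut M m_init g F'"
  then obtain M :: "'m set" and m_init g F' where "finite_memory_fairness doughnut M m_init g F'"
    by blast
  then have "finite {fairness doughnut xs 0 | xs. is_trace doughnut xs 0}"
    by (rule finite_memory_fairness_finite_values)
  then show False
    using infinite_doughnut_fairness_values by contradiction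
qed

end
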